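(* Let $G=(V,E,w)$ be a directed graph with positive arc weights in which all shortest-path distances $d(u,v)$ are finite, let $S\subseteq V$ be a nonempty set of landmarks, let $s\in V$ be a query vertex, let $O\subseteq V$ be a set of objects, and let $k\ge 1$ with $k\le |O|$. For $o\in O$ define the upper bound $ub(s,o)=\min_{L\in S}\bigl(d(s,L)+d(L,o)\bigr)$ and the lower bound $lb(s,o)=\max_{L\in S}\max\{d(s,L)-d(o,L),\, d(L,o)-d(L,s)\}$. Let $U$ be the $k$-th smallest value of $ub(s,o)$ over $o\in O$ (counted with multiplicity), and let $O_{small}=\{o\in O : lb(s,o)\le U\}$. Then every object $o\in O\setminus O_{small}$ satisfies $d(s,o)>U$, while at least $k$ objects of $O$ satisfy $d(s,o)\le U$; consequently every object $o\in O$ with $d(s,o)$ at most the $k$-th smallest value of $\{d(s,o'):o'\in O\}$ lies in $O_{small}$, so a set of $k$ nearest neighbours of $s$ in $O$ (with respect to $d(s,\cdot)$) is contained in $O_{small}$, and the $k$ smallest distances $d(s,o)$ over $O_{small}$ coincide with those over $O$.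
   Context: This is the correctness of the pruning phase of the SALT-kNN algorithm, which restricts a $k$-nearest-neighbour search from $s$ among objects $O$ to the subset $O_{small}$. *)

theory Defs
  imports "Graph_Theory.Shortest_Path" "Graph_Theory.Pair_Digraph" "HOL-Library.Multiset"
begin

text \<open>
  Distances take values in \<^typ>\<open>ereal\<close>, the codomain of \<^const>\<open>wf_digraph.\<mu>\<close>. The differences in
  \<open>landmark_lb\<close> and the choice of \<^const>\<open>Min\<close> and \<^const>\<open>Max\<close> are meaningful for finite distances and
  a finite nonempty set of landmarks.
\<close>

definition landmark_ub :: "('a \<Rightarrow> 'a \<Rightarrow> ereal) \<Rightarrow> 'a set \<Rightarrow> 'a \<Rightarrow> 'a \<Rightarrow> ereal" where
  "landmark_ub d S s x = Min ((\<lambda>l. d s l + d l x) ` S)"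

definition landmark_lb :: "('a \<Rightarrow> 'a \<Rightarrow> ereal) \<Rightarrow> 'a set \<Rightarrow> 'a \<Rightarrow> 'a \<Rightarrow> ereal" where
  "landmark_lb d S s x = Max ((\<lambda>l. max (d s l - d x l) (d l x - d l s)) ` S)"

definition sorted_values :: "('a \<Rightarrow> 'b::linorder) \<Rightarrow> 'a set \<Rightarrow> 'b list" where
  "sorted_values f A = sorted_list_of_multiset (image_mset f (mset_set A))"

text \<open>Counted from 1, with multiplicity; meaningful for finite \<open>A\<close> and \<open>1 \<le> k \<le> card A\<close>.\<close>

definition kth_smallest :: "('a \<Rightarrow> 'b::linorder) \<Rightarrow> 'a set \<Rightarrow> nat \<Rightarrow> 'b" where
  "kth_smallest f A k = sorted_values f A ! (k - 1)"

definition k_nearest :: "('a \<Rightarrow> 'b::linorder) \<Rightarrow> 'a set \<Rightarrow> nat \<Rightarrow> 'a set \<Rightarrow> bool" where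
  "k_nearest f A k K \<longleftrightarrow>
     K \<subseteq> A \<and> finite K \<and> card K = k \<and> (\<forall>x\<in>K. \<forall>y\<in>A - K. f x \<le> f y)"

end

theory Submission
  imports Defs
begin

text \<open>
  The triangle inequality gives \<open>lb(s,x) \<le> d(s,x) \<le> ub(s,x)\<close>. Since \<open>k\<close> objects have upper
  bound at most \<open>U\<close>, they also have distance at most \<open>U\<close>, so the \<open>k\<close>-th smallest distance is at
  most \<open>U\<close>; a pruned object has distance at least its lower bound, hence greater than \<open>U\<close>.
\<close>

lemma mset_sorted_values: "mset (sorted_values f A) = image_mset f (mset_set A)"
  by (simp add: sorted_values_def)

lemma sorted_sorted_values: "sorted (sorted_values f A)"
  by (simp add: sorted_values_def)

lemma length_sorted_values: "length (sorted_values f A) = card A"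
  by (metis mset_sorted_values size_image_mset size_mset size_mset_set)

lemma set_sorted_values: "finite A \<Longrightarrow> set (sorted_values f A) = f ` A"
  by (simp add: sorted_values_def)

text \<open>In a sorted list the entries \<open>\<le> u\<close> form a prefix, so
  \<open>filter\<close> agrees with \<open>takeWhile\<close> and its length is the index at which
  the values first exceed \<open>u\<close>.\<close>

lemma sorted_nth_le_iff_length_filter:
  assumes "sorted xs" and "i < length xs"
  shows "xs ! i \<le> u \<longleftrightarrow> i < length (filter (\<lambda>x. x \<le> u) xs)"
proof -
  have eq: "filter (\<lambda>x. x \<le> u) xs = takeWhile (\<lambda>x. x \<le> u) xs"
    using assms(1)
    by (induction xs) (auto simp: takeWhile_eq_Nil_iff, meson hd_in_set order_trans)
  show ?thesis
  proof
    assume "xs ! i \<le> u"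
    then have "\<forall>j\<le>i. xs ! j \<le> u"
      using assms sorted_nth_mono order_trans by blast
    then show "i < length (filter (\<lambda>x. x \<le> u) xs)"
      unfolding eq using assms(2)
      by (metis linorder_not_less nth_length_takeWhile order_le_less_trans)
  next
    assume "i < length (filter (\<lambda>x. x \<le> u) xs)"
    then show "xs ! i \<le> u"
      unfolding eq by (metis nth_mem set_takeWhileD takeWhile_nth)
  qed
qed

text \<open>Turns order statistics into counting, so that later arguments compare cardinalities of
  sublevel sets instead of sorted lists. With \<open>u\<close> the k-th smallest value itself, it
  says that at least \<open>k\<close> elements reach that value.\<close>

lemma kth_smallest_le_iff:
  assumes "finite A" and "1 \<le> k" and "k \<le> card A"
  shows "kth_smallest f A k \<le> u \<longleftrightarrow> k \<le> card {x \<in> A. f x \<le> u}"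
proof -
  have "length (filter (\<lambda>y. y \<le> u) (sorted_values f A))
      = size (filter_mset (\<lambda>y. y \<le> u) (image_mset f (mset_set A)))"
    by (metis mset_filter mset_sorted_values size_mset)
  also have "\<dots> = card {x \<in> A. f x \<le> u}"
    using assms(1) by (simp add: filter_mset_image_mset filter_mset_mset_set)
  finally have "length (filter (\<lambda>y. y \<le> u) (sorted_values f A)) = card {x \<in> A. f x \<le> u}" .
  then show ?thesis
    unfolding kth_smallest_def
    \<comment> \<open>Since \<open>1 \<le> k\<close>, the zero-based condition
      \<open>k - 1 < n\<close> is the same as \<open>k \<le> n\<close>.\<close>
    using assms sorted_nth_le_iff_length_filter[OF sorted_sorted_values, of "k - 1" f A u]
    by (auto simp: length_sorted_values)
qed

text \<open>Both sides are sorted lists with the same multiset of entries, and a sorted list is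
  determined by its multiset.\<close>

lemma sorted_values_append:
  assumes "finite A" and "C \<subseteq> A" and "\<And>x y. x \<in> C \<Longrightarrow> y \<in> A - C \<Longrightarrow> f x \<le> f y"
  shows "sorted_values f A = sorted_values f C @ sorted_values f (A - C)"
proof -
  have fin: "finite C" "finite (A - C)"
    using assms finite_subset by auto
  have "mset_set A = mset_set C + mset_set (A - C)"
    using mset_set_Union[OF fin] assms(2) by (simp add: Un_absorb1)
  then have "mset (sorted_values f A) = mset (sorted_values f C @ sorted_values f (A - C))"
    by (simp add: mset_sorted_values)
  moreover have "sorted (sorted_values f C @ sorted_values f (A - C))"
    using assms(3) fin by (auto simp: sorted_append sorted_sorted_values set_sorted_values)
  ultimately show ?thesis
    by (metis properties_for_sort sort_sorted_list_of_multiset_eq sorted_sorted_values sorted_sort_id)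
qed

text \<open>For every \<open>D\<close> between the sublevel set and \<open>A\<close>, the sorted
  values of \<open>D\<close> start with those of the sublevel set, which already number at least
  \<open>k\<close>. Both \<open>A\<close> and \<open>B\<close> are such a \<open>D\<close>.\<close>

lemma take_sorted_values_subset:
  assumes "finite A" and "B \<subseteq> A" and "{x \<in> A. f x \<le> u} \<subseteq> B" and "k \<le> card {x \<in> A. f x \<le> u}"
  shows "take k (sorted_values f B) = take k (sorted_values f A)"
proof -
  let ?C = "{x \<in> A. f x \<le> u}"
  have "take k (sorted_values f D) = take k (sorted_values f ?C)"
    if "?C \<subseteq> D" and "D \<subseteq> A" for D
  proof -
    have "sorted_values f D = sorted_values f ?C @ sorted_values f (D - ?C)"
      using that assms(1) finite_subset by (intro sorted_values_append) auto
    then show ?thesis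
      using assms(4) by (simp add: length_sorted_values)
  qed
  from this[of A] this[of B] show ?thesis
    using assms by auto
qed

lemma k_nearest_le_kth_smallest:
  assumes "finite A" and "1 \<le> k" and "k_nearest f A k K" and "x \<in> K"
  shows "f x \<le> kth_smallest f A k"
proof (rule ccontr)
  let ?C = "{y \<in> A. f y \<le> kth_smallest f A k}"
  assume less: "\<not> f x \<le> kth_smallest f A k"
  have K: "K \<subseteq> A" "finite K" "card K = k" "\<forall>x\<in>K. \<forall>y\<in>A - K. f x \<le> f y"
    using assms(3) by (auto simp: k_nearest_def)
  then have "k \<le> card ?C"
    using assms kth_smallest_le_iff card_mono by (metis order_refl)
  \<comment> \<open>An element of \<open>A\<close> outside \<open>K\<close> has value at least
    \<open>f x\<close>, hence above the threshold, and so does \<open>x\<close> itself. Only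
    \<open>k - 1\<close> candidates remain.\<close>
  moreover have "?C \<subseteq> K - {x}"
    using K(4) assms(4) less by (blast intro: order_trans)
  then have "card ?C \<le> card (K - {x})"
    using K(2) by (intro card_mono) auto
  then have "card ?C < k"
    using K assms(2,4) by simp
  ultimately show False by simp
qed

text \<open>Greedy construction: a minimiser of \<open>f\<close> on \<open>A - K\<close> extends
  \<open>k\<close> nearest elements to \<open>k + 1\<close>.\<close>

lemma k_nearest_exists:
  assumes "finite A" and "k \<le> card A"
  shows "\<exists>K. k_nearest f A k K"
  using assms(2)
proof (induction k)
  case 0
  then show ?case by (intro exI[of _ "{}"]) (simp add: k_nearest_def)
next
  case (Suc k)
  then obtain K where K: "K \<subseteq> A" "finite K" "card K = k" "\<forall>x\<in>K. \<forall>y\<in>A - K. f x \<le> f y"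
    by (auto simp: k_nearest_def)
  then have "A - K \<noteq> {}"
    using Suc.prems by (metis Diff_eq_empty_iff card_mono not_less_eq_eq)
  then obtain m where m: "m \<in> A - K" "\<forall>y\<in>A - K. f m \<le> f y"
    using assms(1) arg_min_if_finite[of "A - K" f] by (metis finite_Diff linorder_not_less)
  have "k_nearest f A (Suc k) (insert m K)"
    using K m by (auto simp: k_nearest_def)
  then show ?case ..
qed

context wf_digraph
begin

lemma mu_nonneg:
  assumes "\<And>e. e \<in> arcs G \<Longrightarrow> c e \<ge> 0"
  shows "\<mu> c u v \<ge> 0"
  unfolding \<mu>_def using pos_cost_pos_awalk_cost[OF _ assms] by (auto intro: INF_greatest)

text \<open>Concatenating a walk \<open>p\<close> from \<open>u\<close> to \<open>x\<close> with a
  walk \<open>q\<close> from \<open>x\<close> to \<open>v\<close> bounds \<open>\<mu> c u v\<close>.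
  Taking the infimum over \<open>q\<close> for fixed \<open>p\<close>, and then over
  \<open>p\<close>, gives the claim without assuming that shortest walks exist.\<close>

lemma mu_triangle:
  assumes "\<And>e. e \<in> arcs G \<Longrightarrow> c e \<ge> 0"
  shows "\<mu> c u v \<le> \<mu> c u x + \<mu> c x v"
proof -
  have nonneg: "\<mu> c y z \<ge> 0" for y z
    using assms by (rule mu_nonneg)
  show ?thesis
  proof (cases "\<mu> c x v = \<infinity>")
    case True
    then show ?thesis
      using nonneg[of u x] by simp
  next
    case False
    \<comment> \<open>Nonnegativity excludes the value \<open>-\<infinity>\<close>; finiteness is
      what permits moving this term across an inequality in \<open>ereal\<close>.\<close>
    then have fin: "\<bar>\<mu> c x v\<bar> \<noteq> \<infinity>"
      using nonneg[of x v] by auto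
    have "\<mu> c u v - \<mu> c x v \<le> ereal (awalk_cost c p)" if p: "awalk u p x" for p
    proof -
      have "\<mu> c u v - ereal (awalk_cost c p) \<le> ereal (awalk_cost c q)" if "awalk x q v" for q
        using min_cost_le_walk_cost[OF awalk_appendI[OF p that], where c = c]
        by (simp add: ereal_minus_le add.commute)
      then have "\<mu> c u v - ereal (awalk_cost c p) \<le> \<mu> c x v"
        unfolding \<mu>_def[of c x v] by (auto intro: INF_greatest)
      then show ?thesis
        using fin by (simp add: ereal_minus_le add.commute)
    qed
    then have "\<mu> c u v - \<mu> c x v \<le> \<mu> c u x"
      unfolding \<mu>_def[of c u x] by (auto intro: INF_greatest)
    then show ?thesis
      using fin by (simp add: ereal_minus_le)
  qed
qed

end

lemma le_landmark_ub:
  assumes "finite S" and "S \<noteq> {}" and "\<And>l. l \<in> S \<Longrightarrow> d s x \<le> d s l + d l x"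
  shows "d s x \<le> landmark_ub d S s x"
  using assms by (simp add: landmark_ub_def)

text \<open>Each difference in the maximum is a triangle inequality, through \<open>x\<close> or
  through \<open>s\<close>, with one finite summand moved to the other side.\<close>

lemma landmark_lb_le:
  assumes "finite S" and "S \<noteq> {}"
    and "\<And>l. l \<in> S \<Longrightarrow> d s l \<le> d s x + d x l" and "\<And>l. l \<in> S \<Longrightarrow> d l x \<le> d l s + d s x"
    and "\<And>l. l \<in> S \<Longrightarrow> \<bar>d x l\<bar> \<noteq> \<infinity>" and "\<And>l. l \<in> S \<Longrightarrow> \<bar>d l s\<bar> \<noteq> \<infinity>"
  shows "landmark_lb d S s x \<le> d s x"
proof -
  have "d s l - d x l \<le> d s x" and "d l x - d l s \<le> d s x" if "l \<in> S" for l
    using assms(3-6)[OF that] by (simp_all add: ereal_minus_le add.commute[of _ "d s x"])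
  then show ?thesis
    using assms(1,2) by (simp add: landmark_lb_def)
qed

theorem theorem2:
  fixes G :: "'a pair_pre_digraph"
    and w :: "'a \<times> 'a \<Rightarrow> real"
    and S Obj :: "'a set"
    and s :: 'a
    and k :: nat
  defines "d \<equiv> wf_digraph.\<mu> (with_proj G) w"
  defines "U \<equiv> kth_smallest (landmark_ub d S s) Obj k"
  defines "Small \<equiv> {x \<in> Obj. landmark_lb d S s x \<le> U}"
  assumes "pair_wf_digraph G"
    and "\<And>e. e \<in> parcs G \<Longrightarrow> w e > 0"
    and "\<And>u v. u \<in> pverts G \<Longrightarrow> v \<in> pverts G \<Longrightarrow> \<bar>d u v\<bar> \<noteq> \<infinity>"
    and "S \<subseteq> pverts G" and "finite S" and "S \<noteq> {}"
    and "s \<in> pverts G"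
    and "Obj \<subseteq> pverts G" and "finite Obj"
    and "1 \<le> k" and "k \<le> card Obj"
  shows "(\<forall>x\<in>Obj - Small. d s x > U)
    \<and> card {x \<in> Obj. d s x \<le> U} \<ge> k
    \<and> (\<forall>x\<in>Obj. d s x \<le> kth_smallest (d s) Obj k \<longrightarrow> x \<in> Small)
    \<and> (\<exists>K. k_nearest (d s) Obj k K \<and> K \<subseteq> Small)
    \<and> (\<forall>K. k_nearest (d s) Obj k K \<longrightarrow> K \<subseteq> Small)
    \<and> take k (sorted_values (d s) Small) = take k (sorted_values (d s) Obj)"
proof -
  interpret pair_wf_digraph G by fact
  have triangle: "d u v \<le> d u x + d x v" for u v x
    unfolding d_def using assms(5) by (intro mu_triangle) (simp add: less_imp_le)
  have ub: "d s x \<le> landmark_ub d S s x" for x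
    using assms(8,9) triangle by (intro le_landmark_ub)
  have lb: "landmark_lb d S s x \<le> d s x" if "x \<in> Obj" for x
    using that assms(7-11) triangle by (intro landmark_lb_le assms(6)) auto
  have pruned: "d s x > U" if "x \<in> Obj - Small" for x
    using that lb[of x] by (auto simp: Small_def)
  \<comment> \<open>The counting criterion is applied at \<open>U\<close> itself, where its left
    side holds by reflexivity.\<close>
  have "k \<le> card {x \<in> Obj. landmark_ub d S s x \<le> U}"
    using kth_smallest_le_iff[OF assms(12-14)] unfolding U_def by blast
  also have "\<dots> \<le> card {x \<in> Obj. d s x \<le> U}"
    using assms(12) ub order_trans by (intro card_mono) auto
  finally have count: "k \<le> card {x \<in> Obj. d s x \<le> U}" .
  then have "kth_smallest (d s) Obj k \<le> U"
    using kth_smallest_le_iff[OF assms(12-14)] by blast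
  then have near: "x \<in> Small" if "x \<in> Obj" and "d s x \<le> kth_smallest (d s) Obj k" for x
    using that pruned[of x] by force
  have nearest: "K \<subseteq> Small" if "k_nearest (d s) Obj k K" for K
    using that near k_nearest_le_kth_smallest[OF assms(12,13) that] by (auto simp: k_nearest_def)
  \<comment> \<open>This sublevel set survives pruning and has at least \<open>k\<close> elements,
    so it fixes the first \<open>k\<close> sorted distances of \<open>Small\<close> and
    \<open>Obj\<close> alike.\<close>
  moreover have "{x \<in> Obj. d s x \<le> U} \<subseteq> Small"
    using pruned leD by blast
  then have "take k (sorted_values (d s) Small) = take k (sorted_values (d s) Obj)"
    using assms(12) count by (intro take_sorted_values_subset) (auto simp: Small_def)
  moreover have "\<exists>K. k_nearest (d s) Obj k K"
    using assms(12,14) by (rule k_nearest_exists)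
  ultimately show ?thesis
    using pruned count near by blast
qed

end
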